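(* Let $P\subseteq\mathbb{R}^n$ be a polytope, $f$ a convex function, differentiable on a domain containing $P$, that is smooth with curvature at most $C>0$, and $x^*$ a minimum point of $f$ over $P$. Let $K\ge1$ and run the Parameter-free Lazy Conditional Gradient algorithm (described in the context) with initial value $\Phi_0>0$ satisfying $f(x_1)-f(x^* )\le2\Phi_0$. Then for every $\varepsilon>0$ there is an iteration $$t\le\Big\lceil\log\frac{\Phi_0}{\varepsilon}\Big\rceil+1+4K\Big\lceil\log\frac{\Phi_0}{KC}\Big\rceil+\frac{16K^2C}{\varepsilon}$$ with $f(x_t)-f(x^* )\le\varepsilon$, where $\log$ is the binary logarithm. In particular the algorithm converges at a rate proportional to $1/t$.
   Context: Gradients act by the standard inner product. $f$ is smooth with curvature at most $C$ if $f(\gamma y+(1-\gamma)x)\le f(x)+\gamma\nabla f(x)(y-x)+C\gamma^2/2$ for all $x,y$ and $0\le\gamma\le1$. Weak separation oracle $\mathrm{LPsep}_P(c,x,\Phi,K)$: given $c$, $x\in P$, $\Phi>0$, $K\ge1$, returns either a vertex $y$ of $P$ with $c(x-y)>\Phi/K$, or false, which it may return only if $c(x-z)\le\Phi$ for all $z\in P$. Parameter-free Lazy Conditional Gradient algorithm: start vertex $x_1$ of $P$; initial value $\Phi_0$ (the algorithm's default is $\Phi_0=\max_{x\in P}\nabla f(x_1)(x_1-x)/2$). For $t=1,\dots,T-1$: $v_t=\mathrm{LPsep}_P(\nabla f(x_t),x_t,\Phi_{t-1},K)$; if $v_t$ is false, set $x_{t+1}=x_t$ and $\Phi_t=\Phi_{t-1}/2$;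 otherwise set $\gamma_t\in\arg\min_{0\le\gamma\le1}f((1-\gamma)x_t+\gamma v_t)$, $x_{t+1}=(1-\gamma_t)x_t+\gamma_tv_t$, and $\Phi_t=\Phi_{t-1}$.
   Formalization: The bound on t is replaced by the maximum of 1 and the printed bound, since for ε large compared with Φ₀ the printed expression can be below 1 (even negative) while iterations are numbered from 1; when it is at least 1 the bound is as printed. *)

theory Defs
  imports "HOL-Analysis.Analysis" "HOL-Library.Landau_Symbols"
begin

text \<open>
  Throughout, \<open>f'\<close> is the gradient of \<open>f\<close>, acting on vectors by the inner product.
  The curvature is taken relative to the feasible region \<open>P\<close>.
\<close>

definition curvature_at_most ::
  "'a::real_inner set \<Rightarrow> ('a \<Rightarrow> real) \<Rightarrow> ('a \<Rightarrow> 'a) \<Rightarrow> real \<Rightarrow> bool" where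
  "curvature_at_most P f f' C \<longleftrightarrow>
     (\<forall>x\<in>P. \<forall>y\<in>P. \<forall>\<gamma>\<in>{0..1}.
        f (\<gamma> *\<^sub>R y + (1 - \<gamma>) *\<^sub>R x)
          \<le> f x + \<gamma> * (f' x \<bullet> (y - x)) + C * \<gamma>\<^sup>2 / 2)"

text \<open>
  The set of admissible answers of the weak separation oracle; \<open>None\<close> is the answer
  ``false''. Both kinds of answer may be admissible for the same input, and the oracle
  is free to return either.
\<close>

definition LPsep ::
  "'a::real_inner set \<Rightarrow> 'a \<Rightarrow> 'a \<Rightarrow> real \<Rightarrow> real \<Rightarrow> 'a option set" where
  "LPsep P c x \<Phi> K =
     {Some y | y. y extreme_point_of P \<and> c \<bullet> (x - y) > \<Phi> / K}
     \<union> (if \<forall>z\<in>P. c \<bullet> (x - z) \<le> \<Phi> then {None} else {})"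

text \<open>
  A run of the algorithm, with iterates \<open>x t\<close>, oracle answers \<open>v t\<close> and step sizes
  \<open>\<gamma> t\<close> for \<open>t \<ge> 1\<close> and values \<open>\<Phi> t\<close> for \<open>t \<ge> 0\<close>; \<open>x 0\<close>, \<open>v 0\<close>, \<open>\<gamma> 0\<close> are
  meaningless, as is \<open>\<gamma> t\<close> whenever \<open>v t = None\<close>. The horizon \<open>T\<close> has no influence on the
  iterates, so the run is not truncated.
\<close>

definition lazy_cg_run ::
  "'a::real_inner set \<Rightarrow> ('a \<Rightarrow> real) \<Rightarrow> ('a \<Rightarrow> 'a) \<Rightarrow> real \<Rightarrow> real
    \<Rightarrow> (nat \<Rightarrow> 'a) \<Rightarrow> (nat \<Rightarrow> 'a option) \<Rightarrow> (nat \<Rightarrow> real) \<Rightarrow> (nat \<Rightarrow> real) \<Rightarrow> bool" where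
  "lazy_cg_run P f f' K \<Phi>\<^sub>0 x v \<gamma> \<Phi> \<longleftrightarrow>
     x 1 extreme_point_of P \<and> \<Phi> 0 = \<Phi>\<^sub>0 \<and>
     (\<forall>t\<ge>1. v t \<in> LPsep P (f' (x t)) (x t) (\<Phi> (t - 1)) K \<and>
        (case v t of
           None \<Rightarrow> x (t + 1) = x t \<and> \<Phi> t = \<Phi> (t - 1) / 2
         | Some y \<Rightarrow>
             is_arg_min (\<lambda>s. f ((1 - s) *\<^sub>R x t + s *\<^sub>R y)) (\<lambda>s. s \<in> {0..1}) (\<gamma> t) \<and>
             x (t + 1) = (1 - \<gamma> t) *\<^sub>R x t + \<gamma> t *\<^sub>R y \<and>
             \<Phi> t = \<Phi> (t - 1)))"

end

theory Submission
  imports Defs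
begin

text \<open>
  Write \<open>h\<close> for the primal gap. The invariant \<open>h \<le> 2\<Phi>\<close> holds initially; a negative oracle
  answer certifies \<open>h \<le> \<Phi>\<close> by convexity, so it survives the halving of \<open>\<Phi>\<close>. A positive answer
  decreases \<open>h\<close> by at least \<open>2\<Phi> / q(\<Phi>)\<close>, where \<open>q(\<Phi>) = 4K max(1, KC/\<Phi>)\<close>, hence at most
  \<open>q(\<Phi>)\<close> positive answers occur while \<open>\<Phi>\<close> keeps its value. Along the values
  \<open>\<Phi>\<^sub>0 / 2^j\<close> the costs \<open>q\<close> are first constant and then geometric, and their sum up to \<open>j = i\<close> is at
  most \<open>4K \<lceil>log(\<Phi>\<^sub>0/(KC))\<rceil> + 8K\<^sup>2C 2^i / \<Phi>\<^sub>0\<close>. Finally \<open>h > \<epsilon>\<close> forces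
  \<open>\<Phi>\<^sub>0 / 2^i > \<epsilon>/2\<close>, which bounds \<open>i\<close> as well as the last term.
\<close>

section \<open>Convexity and curvature inequalities along a segment\<close>

text \<open>Restricting \<open>f\<close> to the line through \<open>x\<close> and \<open>z\<close>
  reduces this to the one-variable tangent inequality, with tangent at 0 evaluated at 1. Openness of
  \<open>D\<close> makes 0 interior to the parameter set \<open>A\<close>.\<close>

lemma convex_on_gradient_inequality:
  fixes f :: "'a::real_inner \<Rightarrow> real"
  assumes "open D" "convex_on D f" "x \<in> D" "z \<in> D" and deriv: "GDERIV f x :> d"
  shows "f x - f z \<le> d \<bullet> (x - z)"
proof -
  define p where "p = (\<lambda>s::real. x + s *\<^sub>R (z - x))"
  define A where "A = p -` D"
  have conv: "convex D"
    using assms(2) by (simp add: convex_on_def)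
  have p_comb: "p ((1 - u) *\<^sub>R s + u *\<^sub>R t) = (1 - u) *\<^sub>R p s + u *\<^sub>R p t" for s t u
    by (simp add: p_def algebra_simps)
  have "open A"
    unfolding A_def p_def by (intro open_vimage assms continuous_intros)
  have "convex A"
    unfolding convex_alt using conv p_comb by (auto simp: A_def convex_alt)
  have "convex_on A (f \<circ> p)"
  proof (rule convex_onI)
    show "(f \<circ> p) ((1 - u) *\<^sub>R s + u *\<^sub>R t) \<le> (1 - u) * (f \<circ> p) s + u * (f \<circ> p) t"
      if "0 < u" "u < 1" "s \<in> A" "t \<in> A" for u s t
      using convex_onD[OF assms(2), of u "p s" "p t"] that p_comb[of u s t] by (simp add: A_def)
  qed (fact \<open>convex A\<close>)
  moreover have "((f \<circ> p) has_real_derivative d \<bullet> (z - x)) (at 0 within A)"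
  proof -
    have "(p has_derivative (\<lambda>s. s *\<^sub>R (z - x))) (at 0)"
      unfolding p_def by (auto intro!: derivative_eq_intros)
    moreover have "(f has_derivative (\<lambda>h. h \<bullet> d)) (at (p 0))"
      using deriv by (simp add: gderiv_def p_def)
    ultimately have "((f \<circ> p) has_derivative (\<lambda>h. h \<bullet> d) \<circ> (\<lambda>s. s *\<^sub>R (z - x))) (at 0)"
      by (rule diff_chain_at)
    moreover have "(\<lambda>h. h \<bullet> d) \<circ> (\<lambda>s. s *\<^sub>R (z - x)) = (*) (d \<bullet> (z - x))"
      by (auto simp: inner_commute)
    ultimately show ?thesis
      by (simp add: has_field_derivative_def has_derivative_at_withinI)
  qed
  moreover have "0 \<in> interior A" "1 \<in> A" "connected A"
    using \<open>open A\<close> \<open>convex A\<close> assms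
    by (auto simp: interior_open A_def p_def convex_connected)
  ultimately have "(f \<circ> p) 1 - (f \<circ> p) 0 \<ge> d \<bullet> (z - x) * (1 - 0)"
    using convex_on_imp_above_tangent[of A "f \<circ> p" 0 1] by blast
  then show ?thesis
    by (simp add: p_def inner_diff_right)
qed

text \<open>The step minimising the quadratic upper bound is \<open>g / C\<close>, clipped to 1.
  Since \<open>C * s \<le> g\<close>, the curvature term eats at most half of the linear gain
  \<open>s * g\<close>.\<close>

lemma curvature_at_most_progress:
  assumes "curvature_at_most P f f' C" "x \<in> P" "y \<in> P" "C > 0" "g \<ge> 0"
    and "f' x \<bullet> (x - y) \<ge> g"
  obtains s where "s \<in> {0..1}"
    and "f ((1 - s) *\<^sub>R x + s *\<^sub>R y) \<le> f x - g / 2 * min 1 (g / C)"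
proof
  define s where "s = min 1 (g / C)"
  show s: "s \<in> {0..1}"
    using assms by (auto simp: s_def)
  have "C * s \<le> g"
    using assms(4) by (simp add: s_def min_def field_simps)
  then have "s * (C * s) \<le> s * g"
    using s by (intro mult_left_mono) auto
  moreover have "s * g \<le> s * (f' x \<bullet> (x - y))"
    using s assms by (intro mult_left_mono) auto
  moreover have "f (s *\<^sub>R y + (1 - s) *\<^sub>R x) \<le> f x + s * (f' x \<bullet> (y - x)) + C * s\<^sup>2 / 2"
    using assms s by (auto simp: curvature_at_most_def)
  moreover have "f' x \<bullet> (y - x) = - (f' x \<bullet> (x - y))"
    by (simp add: inner_diff_right)
  ultimately have "f ((1 - s) *\<^sub>R x + s *\<^sub>R y) \<le> f x - g / 2 * s"
    by (simp add: power2_eq_square algebra_simps)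
  then show "f ((1 - s) *\<^sub>R x + s *\<^sub>R y) \<le> f x - g / 2 * min 1 (g / C)"
    by (simp add: s_def)
qed

section \<open>Costs of the phases and their sum\<close>

lemma sum_max_geometric_le:
  fixes u :: real
  assumes "u > 0"
  shows "(\<Sum>j\<le>i. max 1 (2 ^ j / u)) \<le> \<lceil>log 2 u\<rceil> + 2 * 2 ^ i / u"
proof -
  define m where "m = \<lceil>log 2 u\<rceil>"
  have le_m: "log 2 u \<le> m"
    by (simp add: m_def)
  \<comment> \<open>As long as \<open>2 ^ i < u\<close> every term is 1, and integrality gives
    \<open>i + 1 \<le> m\<close>.\<close>
  have initial: "(\<Sum>j\<le>i. max 1 (2 ^ j / u)) \<le> m + 2 * 2 ^ i / u" if "2 ^ i < u" for i
  proof -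
    have "log 2 (2 ^ i) < log 2 u"
      using that by (subst log_less_cancel_iff) (use assms in auto)
    then have "real_of_int (int i) < m"
      using le_m by simp
    then have "int (i + 1) \<le> m"
      unfolding of_int_less_iff by simp
    then have "real (i + 1) \<le> m"
      by (metis of_int_le_iff of_int_of_nat_eq)
    moreover have "(\<Sum>j\<le>i. max 1 (2 ^ j / u)) = (\<Sum>j\<le>i. 1)"
    proof (rule sum.cong)
      fix j assume "j \<in> {..i}"
      then have "(2::real) ^ j \<le> 2 ^ i"
        by (intro power_increasing) auto
      then have "2 ^ j / u \<le> 1"
        using that assms by (subst pos_divide_le_eq) linarith+
      then show "max 1 (2 ^ j / u) = 1"
        by simp
    qed simp
    moreover have "0 \<le> 2 * 2 ^ i / u"
      using assms by simp
    ultimately show ?thesis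
      by simp
  qed
  have "(\<Sum>j\<le>i. max 1 (2 ^ j / u)) \<le> m + 2 * 2 ^ i / u"
  proof (induction i)
    case 0
    show ?case
    proof (cases "1 < u")
      case True
      then show ?thesis using initial[of 0] by simp
    next
      case False
      have "m \<le> 0"
        using False assms by (simp add: m_def)
      \<comment> \<open>Here \<open>m\<close> may be negative. The doubled last term leaves a
        surplus of \<open>1 / u\<close>, which absorbs it because
        \<open>k < 2 ^ k \<le> 1 / u\<close>.\<close>
      define k where "k = nat (- m)"
      have k: "real k = - m"
        using \<open>m \<le> 0\<close> by (simp add: k_def)
      have "u \<le> 2 powr m"
        using le_m assms by (simp add: log_le_iff)
      also have "2 powr m = 2 powr - real k"
        using k by simp
      also have "\<dots> = 1 / 2 ^ k"
        by (simp add: powr_minus_divide powr_realpow)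
      finally have "2 ^ k \<le> 1 / u"
        using assms by (simp add: field_simps)
      then have "- m \<le> 1 / u"
        using of_nat_less_two_power[of k, where ?'a = real] k by linarith
      then show ?thesis
        using False assms by (simp add: max_def field_simps)
    qed
  next
    case (Suc i)
    show ?case
    proof (cases "2 ^ Suc i < u")
      case True
      then show ?thesis by (rule initial)
    next
      case False
      \<comment> \<open>The new term is exactly the increase of \<open>2 * 2 ^ i / u\<close> from
        \<open>i\<close> to \<open>Suc i\<close>.\<close>
      then have "max 1 (2 ^ Suc i / u) = 2 ^ Suc i / u"
        using assms by (simp add: max_def field_simps)
      then show ?thesis
        using Suc.IH by (simp add: add_divide_distrib)
    qed
  qed
  then show ?thesis
    by (simp add: m_def)
qed

text \<open>The ratio of the gap bound 2\<Phi> to the decrease guaranteed by one positive answer.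
  The branches of the maximum correspond to full and short steps. The value is not rounded to an
  integer, so the short-step costs are exactly geometric.\<close>

definition phase_cost :: "real \<Rightarrow> real \<Rightarrow> real \<Rightarrow> real" where
  "phase_cost K C \<Phi> = 4 * K * max 1 (K * C / \<Phi>)"

lemma phase_cost_pos: "K > 0 \<Longrightarrow> phase_cost K C \<Phi> > 0"
  by (simp add: phase_cost_def)

lemma phase_cost_times_progress:
  assumes "K > 0" "C > 0" "\<Phi> > 0"
  shows "phase_cost K C \<Phi> * (\<Phi> / K / 2 * min 1 (\<Phi> / K / C)) = 2 * \<Phi>"
  using assms by (simp add: phase_cost_def max_def min_def field_simps)

lemma sum_phase_cost_le:
  assumes "K > 0" "C > 0" "\<Phi>\<^sub>0 > 0"
  shows "(\<Sum>j\<le>i. phase_cost K C (\<Phi>\<^sub>0 / 2 ^ j))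
           \<le> 4 * K * \<lceil>log 2 (\<Phi>\<^sub>0 / (K * C))\<rceil> + 8 * K\<^sup>2 * C / (\<Phi>\<^sub>0 / 2 ^ i)"
proof -
  have "(\<Sum>j\<le>i. phase_cost K C (\<Phi>\<^sub>0 / 2 ^ j))
          = 4 * K * (\<Sum>j\<le>i. max 1 (2 ^ j / (\<Phi>\<^sub>0 / (K * C))))"
    by (simp add: phase_cost_def sum_distrib_left mult_ac)
  also have "\<dots> \<le> 4 * K * (\<lceil>log 2 (\<Phi>\<^sub>0 / (K * C))\<rceil> + 2 * 2 ^ i / (\<Phi>\<^sub>0 / (K * C)))"
    using assms by (intro mult_left_mono sum_max_geometric_le) auto
  finally show ?thesis
    using assms by (simp add: field_simps power2_eq_square)
qed

section \<open>Single steps and the invariant of a run\<close>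

text \<open>Convexity and differentiability of \<open>f\<close> enter through
  \<open>gap_le_gradient\<close>, the gradient inequality at the minimum point.\<close>

locale lazy_conditional_gradient =
  fixes P :: "'a::real_inner set" and f :: "'a \<Rightarrow> real" and f' :: "'a \<Rightarrow> 'a"
    and K C \<Phi>\<^sub>0 :: real and xstar :: 'a
    and x :: "nat \<Rightarrow> 'a" and v :: "nat \<Rightarrow> 'a option" and \<gamma> \<Phi> :: "nat \<Rightarrow> real"
  assumes convex_P: "convex P"
    and K_ge_1: "K \<ge> 1" and C_pos: "C > 0" and \<Phi>\<^sub>0_pos: "\<Phi>\<^sub>0 > 0"
    and curvature: "curvature_at_most P f f' C"
    and xstar_in: "xstar \<in> P" and xstar_le: "z \<in> P \<Longrightarrow> f xstar \<le> f z"
    and gap_le_gradient: "z \<in> P \<Longrightarrow> f z - f xstar \<le> f' z \<bullet> (z - xstar)"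
    and run: "lazy_cg_run P f f' K \<Phi>\<^sub>0 x v \<gamma> \<Phi>"
    and initial_gap: "f (x 1) - f xstar \<le> 2 * \<Phi>\<^sub>0"
begin

definition gap :: "nat \<Rightarrow> real" where
  "gap t = f (x t) - f xstar"

lemma step_cases:
  assumes "t \<ge> 1" "x t \<in> P" "\<Phi> (t - 1) > 0"
  obtains (negative) "x (t + 1) = x t" "\<Phi> t = \<Phi> (t - 1) / 2" "gap t \<le> \<Phi> (t - 1)"
    | (positive) "x (t + 1) \<in> P" "\<Phi> t = \<Phi> (t - 1)"
        "gap (t + 1) \<le> gap t - 2 * \<Phi> t / phase_cost K C (\<Phi> t)"
proof (cases "v t")
  case None
  then have "\<forall>z\<in>P. f' (x t) \<bullet> (x t - z) \<le> \<Phi> (t - 1)"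
    using run assms(1) by (force simp: lazy_cg_run_def LPsep_def split: if_splits)
  then have "gap t \<le> \<Phi> (t - 1)"
    using gap_le_gradient[OF assms(2)] xstar_in by (force simp: gap_def)
  moreover have "x (t + 1) = x t" "\<Phi> t = \<Phi> (t - 1) / 2"
    using run assms(1) None by (auto simp: lazy_cg_run_def)
  ultimately show ?thesis
    using negative by blast
next
  case (Some y)
  have "v t \<in> LPsep P (f' (x t)) (x t) (\<Phi> (t - 1)) K"
    using run assms(1) by (auto simp: lazy_cg_run_def)
  then have y: "y \<in> P" "f' (x t) \<bullet> (x t - y) \<ge> \<Phi> (t - 1) / K"
    using Some by (auto simp: LPsep_def extreme_point_of_def split: if_splits)
  have argmin: "is_arg_min (\<lambda>s. f ((1 - s) *\<^sub>R x t + s *\<^sub>R y)) (\<lambda>s. s \<in> {0..1}) (\<gamma> t)"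
    and x_next: "x (t + 1) = (1 - \<gamma> t) *\<^sub>R x t + \<gamma> t *\<^sub>R y"
    and \<Phi>_next: "\<Phi> t = \<Phi> (t - 1)"
    using run assms(1) Some by (auto simp: lazy_cg_run_def)
  have in_P: "x (t + 1) \<in> P"
    using argmin convex_P assms(2) y(1) unfolding x_next by (auto simp: is_arg_min_def convex_alt)
  define r where "r = \<Phi> t / K / 2 * min 1 (\<Phi> t / K / C)"
  have "\<Phi> t / K \<ge> 0" "f' (x t) \<bullet> (x t - y) \<ge> \<Phi> t / K"
    using assms K_ge_1 y \<Phi>_next by auto
  then obtain s where "s \<in> {0..1}" "f ((1 - s) *\<^sub>R x t + s *\<^sub>R y) \<le> f (x t) - r"
    unfolding r_def by (rule curvature_at_most_progress[OF curvature assms(2) y(1) C_pos])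
  \<comment> \<open>The line search does at least as well as the explicit step
    \<open>s\<close>.\<close>
  then have "gap (t + 1) \<le> gap t - r"
    using argmin unfolding gap_def x_next is_arg_min_def by (smt (verit))
  moreover have "phase_cost K C (\<Phi> t) * r = 2 * \<Phi> t"
    unfolding r_def using assms K_ge_1 C_pos \<Phi>_next by (intro phase_cost_times_progress) auto
  then have "r = 2 * \<Phi> t / phase_cost K C (\<Phi> t)"
    using phase_cost_pos[of K C "\<Phi> t"] K_ge_1 by (simp add: field_simps)
  ultimately show ?thesis
    using positive in_P \<Phi>_next by blast
qed

text \<open>
  The last summand counts the positive answers in the current phase: it grows by at least one
  with each of them and never exceeds the cost of the phase.
\<close>

lemma run_invariant:
  assumes "t \<ge> 1"
  shows "x t \<in> P \<and> gap t \<le> 2 * \<Phi> (t - 1) \<and>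
    (\<exists>i. \<Phi> (t - 1) = \<Phi>\<^sub>0 / 2 ^ i \<and>
      real t \<le> 1 + i + (\<Sum>j<i. phase_cost K C (\<Phi>\<^sub>0 / 2 ^ j))
                 + phase_cost K C (\<Phi> (t - 1)) * (1 - gap t / (2 * \<Phi> (t - 1))))"
  using assms
proof (induction t rule: nat_induct_at_least)
  case base
  have "\<Phi> 0 = \<Phi>\<^sub>0" "x 1 \<in> P"
    using run by (auto simp: lazy_cg_run_def extreme_point_of_def)
  moreover have "phase_cost K C \<Phi>\<^sub>0 * (1 - gap 1 / (2 * \<Phi>\<^sub>0)) \<ge> 0"
    using initial_gap \<Phi>\<^sub>0_pos phase_cost_pos[of K C \<Phi>\<^sub>0] K_ge_1
    by (intro mult_nonneg_nonneg) (auto simp: gap_def field_simps)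
  ultimately show ?case
    using initial_gap by (auto simp: gap_def intro!: exI[of _ 0])
next
  case (Suc t)
  then obtain i where i: "\<Phi> (t - 1) = \<Phi>\<^sub>0 / 2 ^ i"
    and t: "real t \<le> 1 + i + (\<Sum>j<i. phase_cost K C (\<Phi>\<^sub>0 / 2 ^ j))
                 + phase_cost K C (\<Phi> (t - 1)) * (1 - gap t / (2 * \<Phi> (t - 1)))"
    by blast
  have in_P: "x t \<in> P" and gap_t: "gap t \<le> 2 * \<Phi> (t - 1)"
    using Suc.IH by auto
  have gap_nonneg: "gap t \<ge> 0"
    using xstar_le[OF in_P] by (simp add: gap_def)
  have \<Phi>_pos: "\<Phi> (t - 1) > 0"
    using i \<Phi>\<^sub>0_pos by simp
  have cost_pos: "phase_cost K C z > 0" for z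
    using K_ge_1 by (intro phase_cost_pos) simp
  from \<open>1 \<le> t\<close> in_P \<Phi>_pos show ?case
  proof (cases rule: step_cases)
    case negative
    then have gap_eq: "gap (Suc t) = gap t"
      by (simp add: gap_def)
    \<comment> \<open>The closing phase is charged in full and moves into the sum. The count of the
      new phase starts nonnegative because the gap is at most twice the halved value, and the
      negative answer itself is paid for by \<open>Suc i\<close>.\<close>
    have "phase_cost K C (\<Phi> (t - 1)) * (1 - gap t / (2 * \<Phi> (t - 1)))
            \<le> phase_cost K C (\<Phi>\<^sub>0 / 2 ^ i) * 1"
      unfolding i using gap_nonneg \<Phi>\<^sub>0_pos cost_pos less_imp_le
      by (intro mult_left_mono) auto
    moreover have "phase_cost K C (\<Phi> t) * (1 - gap t / (2 * \<Phi> t)) \<ge> 0"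
      using negative \<Phi>_pos cost_pos less_imp_le
      by (intro mult_nonneg_nonneg) (auto simp: field_simps)
    ultimately have "real (Suc t) \<le> 1 + Suc i + (\<Sum>j<Suc i. phase_cost K C (\<Phi>\<^sub>0 / 2 ^ j))
                 + phase_cost K C (\<Phi> t) * (1 - gap t / (2 * \<Phi> t))"
      using t by simp
    moreover have "\<Phi> t = \<Phi>\<^sub>0 / 2 ^ Suc i"
      using negative i by simp
    ultimately show ?thesis
      unfolding diff_Suc_1 gap_eq using negative(1,3) in_P
      by (intro conjI exI[of _ "Suc i"]) (simp_all add: \<open>\<Phi> t = \<Phi> (t - 1) / 2\<close>)
  next
    case positive
    define q where "q = phase_cost K C (\<Phi> t)"
    have "q > 0" "\<Phi> t > 0"
      using cost_pos \<Phi>_pos positive by (auto simp: q_def)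
    have drop: "gap (Suc t) \<le> gap t - 2 * \<Phi> t / q"
      using positive by (simp add: q_def)
    then have "gap (Suc t) / (2 * \<Phi> t) \<le> (gap t - 2 * \<Phi> t / q) / (2 * \<Phi> t)"
      using \<open>\<Phi> t > 0\<close> by (intro divide_right_mono) auto
    also have "\<dots> = gap t / (2 * \<Phi> t) - 1 / q"
      using \<open>\<Phi> t > 0\<close> by (simp add: diff_divide_distrib)
    finally have "q * (1 - gap t / (2 * \<Phi> t) + 1 / q) \<le> q * (1 - gap (Suc t) / (2 * \<Phi> t))"
      using \<open>q > 0\<close> by (intro mult_left_mono) auto
    then have "q * (1 - gap t / (2 * \<Phi> t)) + 1 \<le> q * (1 - gap (Suc t) / (2 * \<Phi> t))"
      using \<open>q > 0\<close> by (simp add: distrib_left)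
    then have "real (Suc t) \<le> 1 + i + (\<Sum>j<i. phase_cost K C (\<Phi>\<^sub>0 / 2 ^ j))
                 + q * (1 - gap (Suc t) / (2 * \<Phi> t))"
      using t positive unfolding q_def by simp
    moreover have "2 * \<Phi> t / q > 0"
      using \<open>q > 0\<close> \<open>\<Phi> t > 0\<close> by simp
    then have "gap (Suc t) \<le> 2 * \<Phi> t"
      using drop gap_t positive by linarith
    ultimately show ?thesis
      using positive i by (auto simp: q_def)
  qed
qed

section \<open>Iteration bounds and convergence rate\<close>

lemma gap_nonneg: "t \<ge> 1 \<Longrightarrow> gap t \<ge> 0"
  using run_invariant xstar_le by (simp add: gap_def)

text \<open>Charging the current phase in full as well removes the gap from the bound on
  \<open>t\<close>.\<close>

lemma iteration_bound:
  assumes "t \<ge> 1"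
  obtains i where "\<Phi> (t - 1) = \<Phi>\<^sub>0 / 2 ^ i" "gap t \<le> 2 * \<Phi> (t - 1)"
    "real t \<le> 1 + i + 4 * K * \<lceil>log 2 (\<Phi>\<^sub>0 / (K * C))\<rceil> + 8 * K\<^sup>2 * C / \<Phi> (t - 1)"
proof -
  obtain i where i: "\<Phi> (t - 1) = \<Phi>\<^sub>0 / 2 ^ i" and gap_t: "gap t \<le> 2 * \<Phi> (t - 1)"
    and t: "real t \<le> 1 + i + (\<Sum>j<i. phase_cost K C (\<Phi>\<^sub>0 / 2 ^ j))
                 + phase_cost K C (\<Phi> (t - 1)) * (1 - gap t / (2 * \<Phi> (t - 1)))"
    using run_invariant[OF assms] by blast
  have "phase_cost K C (\<Phi> (t - 1)) * (1 - gap t / (2 * \<Phi> (t - 1)))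
            \<le> phase_cost K C (\<Phi>\<^sub>0 / 2 ^ i) * 1"
    unfolding i using gap_nonneg[OF assms] \<Phi>\<^sub>0_pos phase_cost_pos[of K] K_ge_1 less_imp_le
    by (intro mult_left_mono) auto
  then have "real t \<le> 1 + i + (\<Sum>j\<le>i. phase_cost K C (\<Phi>\<^sub>0 / 2 ^ j))"
    using t by (simp flip: lessThan_Suc_atMost)
  moreover have "(\<Sum>j\<le>i. phase_cost K C (\<Phi>\<^sub>0 / 2 ^ j))
      \<le> 4 * K * \<lceil>log 2 (\<Phi>\<^sub>0 / (K * C))\<rceil> + 8 * K\<^sup>2 * C / (\<Phi>\<^sub>0 / 2 ^ i)"
    using K_ge_1 C_pos \<Phi>\<^sub>0_pos by (intro sum_phase_cost_le) auto
  ultimately show ?thesis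
    using that[OF i gap_t] i by simp
qed

text \<open>The threshold is put on \<open>\<Phi> (t - 1)\<close> and not on \<open>gap t\<close>,
  so that the bound also applies to the first iterate whose gap is at most \<epsilon>.\<close>

lemma iteration_bound_of_threshold:
  assumes "t \<ge> 1" "\<epsilon> > 0" "\<epsilon> < 2 * \<Phi> (t - 1)"
  shows "real t \<le> \<lceil>log 2 (\<Phi>\<^sub>0 / \<epsilon>)\<rceil> + 1 + 4 * K * \<lceil>log 2 (\<Phi>\<^sub>0 / (K * C))\<rceil>
                    + 16 * K\<^sup>2 * C / \<epsilon>"
proof -
  obtain i where i: "\<Phi> (t - 1) = \<Phi>\<^sub>0 / 2 ^ i"
    and t: "real t \<le> 1 + i + 4 * K * \<lceil>log 2 (\<Phi>\<^sub>0 / (K * C))\<rceil> + 8 * K\<^sup>2 * C / \<Phi> (t - 1)"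
    by (rule iteration_bound[OF assms(1)])
  have "2 ^ i < 2 * (\<Phi>\<^sub>0 / \<epsilon>)"
    using assms(2,3) unfolding i by (simp add: field_simps)
  then have "log 2 (2 ^ i) < log 2 (2 * (\<Phi>\<^sub>0 / \<epsilon>))"
    using assms \<Phi>\<^sub>0_pos by (subst log_less_cancel_iff) auto
  also have "\<dots> = 1 + log 2 (\<Phi>\<^sub>0 / \<epsilon>)"
    using assms \<Phi>\<^sub>0_pos by (subst log_mult) auto
  finally have "real i < 1 + log 2 (\<Phi>\<^sub>0 / \<epsilon>)"
    by simp
  \<comment> \<open>The factor 2 in the threshold costs no extra iteration: an integer below
    \<open>1 + a\<close> is at most the ceiling of \<open>a\<close>.\<close>
  then have "int i \<le> \<lceil>log 2 (\<Phi>\<^sub>0 / \<epsilon>)\<rceil>"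
    by (simp add: le_ceiling_iff)
  then have "real i \<le> \<lceil>log 2 (\<Phi>\<^sub>0 / \<epsilon>)\<rceil>"
    by (metis of_int_le_iff of_int_of_nat_eq)
  moreover have "8 * K\<^sup>2 * C / \<Phi> (t - 1) \<le> 8 * K\<^sup>2 * C / (\<epsilon> / 2)"
    using assms C_pos by (intro divide_left_mono) auto
  ultimately show ?thesis
    using t by simp
qed

text \<open>The number \<open>i\<close> of halvings is at most \<open>2 ^ i\<close>, which is the
  ratio of \<open>\<Phi>\<^sub>0\<close> to the current value of \<Phi>. So every term of the
  iteration bound is at most a constant over \<Phi>, whence \<Phi> and the gap are of order
  1/t.\<close>

lemma gap_bigo: "gap \<in> O(\<lambda>t. 1 / real t)"
proof -
  \<comment> \<open>The absolute value is needed to scale \<open>m\<close> by \<open>2 ^ i\<close>,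
    since the ceiling may be negative.\<close>
  define m where "m = \<bar>4 * K * \<lceil>log 2 (\<Phi>\<^sub>0 / (K * C))\<rceil>\<bar>"
  define M where "M = (2 + m) * \<Phi>\<^sub>0 + 8 * K\<^sup>2 * C"
  have "norm (gap t) \<le> 2 * M * norm (1 / real t)" if "t \<ge> 1" for t
  proof -
    obtain i where i: "\<Phi> (t - 1) = \<Phi>\<^sub>0 / 2 ^ i" and gap_t: "gap t \<le> 2 * \<Phi> (t - 1)"
      and "real t \<le> 1 + i + 4 * K * \<lceil>log 2 (\<Phi>\<^sub>0 / (K * C))\<rceil> + 8 * K\<^sup>2 * C / \<Phi> (t - 1)"
      by (rule iteration_bound[OF \<open>t \<ge> 1\<close>])
    then have "real t \<le> 1 + i + m + 8 * K\<^sup>2 * C / \<Phi> (t - 1)"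
      by (simp add: m_def)
    also have "1 + i + m \<le> (2 + m) * 2 ^ i"
    proof -
      have "real i \<le> 2 ^ i"
        by (intro less_imp_le of_nat_less_two_power)
      moreover have "(1::real) \<le> 2 ^ i"
        by simp
      moreover from this have "m * 1 \<le> m * 2 ^ i"
        by (intro mult_left_mono) (auto simp: m_def)
      ultimately show ?thesis
        unfolding distrib_right by linarith
    qed
    also have "(2 + m) * 2 ^ i + 8 * K\<^sup>2 * C / \<Phi> (t - 1) = M / \<Phi> (t - 1)"
      using \<Phi>\<^sub>0_pos unfolding i M_def by (simp add: field_simps)
    finally have "real t * \<Phi> (t - 1) \<le> M"
      unfolding i using \<Phi>\<^sub>0_pos by (simp add: field_simps)
    then have "\<Phi> (t - 1) \<le> M / real t"
      using that by (simp add: field_simps)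
    then show ?thesis
      using gap_t gap_nonneg[OF that] by simp
  qed
  then show ?thesis
    by (intro bigoI[of _ "2 * M"] eventually_mono[OF eventually_ge_at_top[of 1]]) auto
qed

text \<open>The first good iterate itself is bounded, which avoids adding 1 to the index of the last
  bad one. The \<open>max 1\<close> covers a good starting vertex: for large \<epsilon> the other
  expression can drop below 1.\<close>

lemma exists_iteration:
  assumes "\<epsilon> > 0"
  shows "\<exists>t\<ge>1. real t \<le> max 1 (\<lceil>log 2 (\<Phi>\<^sub>0 / \<epsilon>)\<rceil> + 1 + 4 * K * \<lceil>log 2 (\<Phi>\<^sub>0 / (K * C))\<rceil>
                             + 16 * K\<^sup>2 * C / \<epsilon>) \<and> gap t \<le> \<epsilon>"
proof -
  define B where "B = \<lceil>log 2 (\<Phi>\<^sub>0 / \<epsilon>)\<rceil> + 1 + 4 * K * \<lceil>log 2 (\<Phi>\<^sub>0 / (K * C))\<rceil>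
                             + 16 * K\<^sup>2 * C / \<epsilon>"
  have above: "\<epsilon> < 2 * \<Phi> (t - 1)" if "t \<ge> 1" "\<epsilon> < gap t" for t
    using run_invariant[OF that(1)] that(2) by linarith
  have "\<exists>t. t \<ge> 1 \<and> gap t \<le> \<epsilon>"
  proof (rule ccontr)
    assume "\<nexists>t. t \<ge> 1 \<and> gap t \<le> \<epsilon>"
    then have "real t \<le> B" if "t \<ge> 1" for t
      using iteration_bound_of_threshold[OF that assms] above that
      unfolding B_def by force
    moreover obtain t where "real t > max 1 B"
      using reals_Archimedean2 by blast
    moreover from this have "t \<ge> 1"
      by simp
    ultimately show False
      by fastforce
  qed
  then obtain t where t: "t \<ge> 1" "gap t \<le> \<epsilon>" and first: "\<And>s. s \<ge> 1 \<Longrightarrow> s < t \<Longrightarrow> gap s > \<epsilon>"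
    using exists_least_iff[of "\<lambda>t. t \<ge> 1 \<and> gap t \<le> \<epsilon>"] by (metis not_le)
  have "real t \<le> max 1 B"
  proof (cases "t = 1")
    case False
    then obtain s where s: "t = s + 1" "s \<ge> 1"
      using t that[of "t - 1"] by simp
    have "gap s > \<epsilon>"
      using first s by simp
    have "x s \<in> P" "\<Phi> (s - 1) > 0"
      using run_invariant[OF s(2)] \<Phi>\<^sub>0_pos by auto
    \<comment> \<open>A negative answer leaves the gap unchanged, so the first good iterate follows a positive
      one and \<open>\<Phi>\<close> still has the value it had while the gap exceeded \<open>\<epsilon>\<close>.\<close>
    with s(2) have "\<Phi> s = \<Phi> (s - 1)"
    proof (cases rule: step_cases)
      case negative
      then show ?thesis
        using t s \<open>gap s > \<epsilon>\<close> by (simp add: gap_def)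
    qed
    then have "real t \<le> B"
      using iteration_bound_of_threshold[OF t(1) assms] above[OF s(2) \<open>gap s > \<epsilon>\<close>] s
      unfolding B_def by simp
    then show ?thesis
      by simp
  qed simp
  then show ?thesis
    using t unfolding B_def by blast
qed

end

theorem theorem4p1:
  fixes P D :: "(real ^ 'n) set"
    and f :: "real ^ 'n \<Rightarrow> real"
    and f' :: "real ^ 'n \<Rightarrow> real ^ 'n"
    and C K \<Phi>\<^sub>0 :: real
    and xstar :: "real ^ 'n"
    and x :: "nat \<Rightarrow> real ^ 'n"
    and v :: "nat \<Rightarrow> (real ^ 'n) option"
    and \<gamma> \<Phi> :: "nat \<Rightarrow> real"
  assumes "polytope P"
    and "open D" and "P \<subseteq> D"
    and "convex_on D f"
    and "\<And>z. z \<in> D \<Longrightarrow> GDERIV f z :> f' z"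
    and "C > 0"
    and "curvature_at_most P f f' C"
    and "is_arg_min f (\<lambda>z. z \<in> P) xstar"
    and "K \<ge> 1"
    and "\<Phi>\<^sub>0 > 0"
    and "lazy_cg_run P f f' K \<Phi>\<^sub>0 x v \<gamma> \<Phi>"
    and "f (x 1) - f xstar \<le> 2 * \<Phi>\<^sub>0"
  shows "(\<forall>\<epsilon>>0. \<exists>t\<ge>1.
            real t \<le> max 1 (\<lceil>log 2 (\<Phi>\<^sub>0 / \<epsilon>)\<rceil> + 1 + 4 * K * \<lceil>log 2 (\<Phi>\<^sub>0 / (K * C))\<rceil>
                             + 16 * K\<^sup>2 * C / \<epsilon>) \<and>
            f (x t) - f xstar \<le> \<epsilon>)
         \<and> (\<lambda>t. f (x t) - f xstar) \<in> O(\<lambda>t. 1 / real t)"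
proof -
  have min: "xstar \<in> P" "\<And>z. z \<in> P \<Longrightarrow> f xstar \<le> f z"
    using assms(8) by (auto simp: is_arg_min_def not_less)
  interpret lazy_conditional_gradient P f f' K C \<Phi>\<^sub>0 xstar x v \<gamma> \<Phi>
  proof
    show "f z - f xstar \<le> f' z \<bullet> (z - xstar)" if "z \<in> P" for z
      using assms(2-5) min that by (intro convex_on_gradient_inequality[of D]) auto
  qed (use assms min polytope_imp_convex in auto)
  show ?thesis
    using exists_iteration gap_bigo unfolding gap_def by blast
qed

end
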